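(* Let $2\le r<\infty$, $2^{r-1}\le n\le2^r-1$, let $\alpha>0$ be a real constant, and let $F^n(p;\zeta)$ be the image of an original $f:\mathbf R^n\to\mathcal A_r$ with respect to either the Cartesian kernel (C) or the spherical kernel (S). Then the image of the function $t\mapsto f(\alpha t)$ exists and equals $F^n(p/\alpha;\zeta)/\alpha^n$.
   Context: Cayley–Dickson algebras: $\mathcal A_0=\mathbf R$ and $\mathcal A_{r+1}=\mathcal A_r\oplus\mathcal A_r\mathbf l$ with $(\xi+\eta\mathbf l)(\gamma+\delta\mathbf l)=(\xi\gamma-\delta^*\eta)+(\delta\xi+\eta\gamma^* )\mathbf l$, $(\xi+\eta\mathbf l)^*=\xi^*-\eta\mathbf l$. The standard basis of $\mathcal A_r$ is $i_0=1,i_1,\dots,i_{2^r-1}$, with $i_j^2=-1$, $i_ji_k=-i_ki_j$ for $j\ne k$, $j,k\ge1$. $\mathrm{Re}(z)=(z+z^* )/2$, $|z|^2=zz^*$, $\exp(z)=\sum_kz^k/k!$. Write $p=\sum_jp_ji_j$, $\zeta=\sum_j\zeta_ji_j$ with real $p_j,\zeta_j$. When $n<2^r-1$ one puts $p_m=\zeta_m=t_m=0$ for $m>n$. Originals: $f:\mathbf R^n\to\mathcal A_r$ is an original if (1) $f$ is continuous almost everywhere for the Lebesgue measure; (2) each partial function $t_j\mapsto f(t)$ has on each finite interval only finitely many discontinuities, all of the first kind; (3) each partial function $g_j(t_j)=f(t)$ satisfies, except possibly at its discontinuities of the first kind, a Hölder condition $|g_j(t_j+h)-g_j(t_j)|\le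 A_j|h|^{\alpha_j}$ for $|h|<\delta_j$, with constants $0<\alpha_j\le1$, $A_j,\delta_j>0$ (for the given $t$); (4) there are real $a_1,a_{-1}$ and constants $C_v>0$ such that for each $v\in\{-1,1\}^n$, $|f(t)|<C_v\exp(\sum_ja_{v_j}t_j)$ whenever $v_jt_j\ge0$ for all $j$. The image is considered for $p\in W_f=\{p\in\mathcal A_r:a_1<\mathrm{Re}(p)<a_{-1}\}$. Kernels: (C) Cartesian: $u(p,t;\zeta)=p_0(t_1+\dots+t_n)+\sum_{j=1}^np_jt_ji_j+\zeta$. (S) Spherical: with $s_j=t_j+\dots+t_n$, $K=2^r-1$, $\phi_j=p_js_j+\zeta_j$: $u=p_0s_1+M+\zeta_0$, $M=\phi_1[i_1\cos\phi_2+i_2\sin\phi_2\cos\phi_3+\dots+i_{K-1}\sin\phi_2\cdots\sin\phi_{K-1}\cos\phi_K+i_K\sin\phi_2\cdots\sin\phi_K]$. Image: $F^n(p;\zeta)=\int_{\mathbf R^n}f(t)\exp(-u(p,t;\zeta))\,dt$. *)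

theory Defs
  imports "HOL-Analysis.Analysis"
begin

section \<open>Cayley--Dickson algebras\<close>

text \<open>
  An element of the algebra \<open>\<A>\<^sub>r\<close> is represented by its family of real coordinates
  with respect to the standard basis \<open>i\<^sub>0, \<dots>, i\<^bsub>2^r - 1\<^esub>\<close>, extended by \<open>0\<close>.
  The basis of \<open>\<A>\<^bsub>r+1\<^esub> = \<A>\<^sub>r \<oplus> \<A>\<^sub>r l\<close> is obtained from that of
  \<open>\<A>\<^sub>r\<close> by adding \<open>i\<^bsub>2^r + j\<^esub> = i\<^sub>j l\<close> for \<open>j < 2^r\<close>. Since only finitely
  many coordinates are nonzero, the product topology on \<open>nat \<Rightarrow> real\<close> induces the
  Euclidean topology on \<open>\<A>\<^sub>r\<close>.
\<close>

type_synonym cd = "nat \<Rightarrow> real"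

definition cd_carrier :: "nat \<Rightarrow> cd set" where
  "cd_carrier r = {z. \<forall>j\<ge>2 ^ r. z j = 0}"

definition cd_basis :: "nat \<Rightarrow> cd" where
  "cd_basis j = (\<lambda>k. if k = j then 1 else 0)"

text \<open>\<open>cd_pair r \<xi> \<eta>\<close> is \<open>\<xi> + \<eta> l\<close>, with components \<open>cd_fst r\<close> and \<open>cd_snd r\<close>.\<close>

definition cd_pair :: "nat \<Rightarrow> cd \<Rightarrow> cd \<Rightarrow> cd" where
  "cd_pair r \<xi> \<eta> =
    (\<lambda>j. if j < 2 ^ r then \<xi> j else if j < 2 ^ Suc r then \<eta> (j - 2 ^ r) else 0)"

definition cd_fst :: "nat \<Rightarrow> cd \<Rightarrow> cd" where
  "cd_fst r z = (\<lambda>j. if j < 2 ^ r then z j else 0)"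

definition cd_snd :: "nat \<Rightarrow> cd \<Rightarrow> cd" where
  "cd_snd r z = (\<lambda>j. if j < 2 ^ r then z (2 ^ r + j) else 0)"

primrec cd_conj :: "nat \<Rightarrow> cd \<Rightarrow> cd" where
  "cd_conj 0 z = z"
| "cd_conj (Suc r) z = cd_pair r (cd_conj r (cd_fst r z)) (\<lambda>j. - cd_snd r z j)"

primrec cd_mult :: "nat \<Rightarrow> cd \<Rightarrow> cd \<Rightarrow> cd" where
  "cd_mult 0 x y = (\<lambda>j. if j = 0 then x 0 * y 0 else 0)"
| "cd_mult (Suc r) x y =
    (let \<xi> = cd_fst r x; \<eta> = cd_snd r x; \<gamma> = cd_fst r y; \<delta> = cd_snd r y
     in cd_pair r
          (\<lambda>j. cd_mult r \<xi> \<gamma> j - cd_mult r (cd_conj r \<delta>) \<eta> j)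
          (\<lambda>j. cd_mult r \<delta> \<xi> j + cd_mult r \<eta> (cd_conj r \<gamma>) j))"

text \<open>
  The elements \<open>(z + z\<^sup>*)/2\<close> and \<open>z z\<^sup>*\<close> are real multiples of \<open>i\<^sub>0\<close>, hence they are
  identified with their zeroth coordinates.
\<close>

definition cd_Re :: "nat \<Rightarrow> cd \<Rightarrow> real" where
  "cd_Re r z = (z 0 + cd_conj r z 0) / 2"

definition cd_norm :: "nat \<Rightarrow> cd \<Rightarrow> real" where
  "cd_norm r z = sqrt (cd_mult r z (cd_conj r z) 0)"

primrec cd_power :: "nat \<Rightarrow> cd \<Rightarrow> nat \<Rightarrow> cd" where
  "cd_power r z 0 = cd_basis 0"
| "cd_power r z (Suc k) = cd_mult r z (cd_power r z k)"

definition cd_exp :: "nat \<Rightarrow> cd \<Rightarrow> cd" where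
  "cd_exp r z = (\<lambda>j. \<Sum>k. cd_power r z k j / fact k)"

section \<open>Originals\<close>

text \<open>
  Points \<open>(t\<^sub>1, \<dots>, t\<^sub>n)\<close> of \<open>n\<close>-space are the extensional functions on \<open>{1..n}\<close>;
  on these the product topology of \<open>nat \<Rightarrow> real\<close> again induces the Euclidean one.
  The measure is completed because an almost everywhere continuous function need not
  be Borel measurable.
\<close>

definition Rn :: "nat \<Rightarrow> (nat \<Rightarrow> real) set" where
  "Rn n = {1..n} \<rightarrow>\<^sub>E UNIV"

definition Leb :: "nat \<Rightarrow> (nat \<Rightarrow> real) measure" where
  "Leb n = completion (\<Pi>\<^sub>M j\<in>{1..n}. (lborel :: real measure))"

definition dilate :: "nat \<Rightarrow> real \<Rightarrow> (nat \<Rightarrow> real) \<Rightarrow> (nat \<Rightarrow> real)" where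
  "dilate n \<alpha> t = (\<lambda>j\<in>{1..n}. \<alpha> * t j)"

definition first_kind_discontinuity :: "(real \<Rightarrow> cd) \<Rightarrow> real \<Rightarrow> bool" where
  "first_kind_discontinuity g x \<longleftrightarrow>
    \<not> isCont g x \<and> (\<exists>l. (g \<longlongrightarrow> l) (at_left x)) \<and> (\<exists>l. (g \<longlongrightarrow> l) (at_right x))"

definition finitely_many_first_kind_discontinuities :: "(real \<Rightarrow> cd) \<Rightarrow> bool" where
  "finitely_many_first_kind_discontinuities g \<longleftrightarrow>
    (\<forall>a b. finite {x \<in> {a..b}. \<not> isCont g x}) \<and>
    (\<forall>x. \<not> isCont g x \<longrightarrow> first_kind_discontinuity g x)"

definition holder_at :: "nat \<Rightarrow> (real \<Rightarrow> cd) \<Rightarrow> real \<Rightarrow> bool" where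
  "holder_at r g x \<longleftrightarrow>
    (\<exists>\<beta> A \<delta>. 0 < \<beta> \<and> \<beta> \<le> 1 \<and> 0 < A \<and> 0 < \<delta> \<and>
      (\<forall>h. \<bar>h\<bar> < \<delta> \<longrightarrow> cd_norm r (\<lambda>k. g (x + h) k - g x k) \<le> A * \<bar>h\<bar> powr \<beta>))"

text \<open>The growth exponents \<open>a\<^sub>1\<close> and \<open>a\<^bsub>-1\<^esub>\<close> (here \<open>am1\<close>) are explicit parameters,
  since the strip on which the image is considered depends on them.\<close>

definition original :: "nat \<Rightarrow> nat \<Rightarrow> real \<Rightarrow> real \<Rightarrow> ((nat \<Rightarrow> real) \<Rightarrow> cd) \<Rightarrow> bool" where
  "original r n a1 am1 f \<longleftrightarrow>
    f \<in> Rn n \<rightarrow> cd_carrier r \<and>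
    (AE t in Leb n. continuous (at t within Rn n) f) \<and>
    (\<forall>t\<in>Rn n. \<forall>j\<in>{1..n}. finitely_many_first_kind_discontinuities (\<lambda>x. f (t(j := x)))) \<and>
    (\<forall>t\<in>Rn n. \<forall>j\<in>{1..n}.
       \<not> first_kind_discontinuity (\<lambda>x. f (t(j := x))) (t j) \<longrightarrow>
       holder_at r (\<lambda>x. f (t(j := x))) (t j)) \<and>
    (\<forall>v \<in> {1..n} \<rightarrow>\<^sub>E {-1, 1::real}. \<exists>C>0. \<forall>t\<in>Rn n. (\<forall>j\<in>{1..n}. v j * t j \<ge> 0) \<longrightarrow>
       cd_norm r (f t) < C * exp (\<Sum>j=1..n. (if v j = 1 then a1 else am1) * t j))"

section \<open>Kernels and images\<close>

definition kernel_C :: "nat \<Rightarrow> cd \<Rightarrow> (nat \<Rightarrow> real) \<Rightarrow> cd \<Rightarrow> cd" where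
  "kernel_C n p t \<zeta> =
    (\<lambda>k. p 0 * (\<Sum>j=1..n. t j) * cd_basis 0 k + (\<Sum>j=1..n. p j * t j * cd_basis j k) + \<zeta> k)"

text \<open>For \<open>j > n\<close> the sum \<open>s j\<close> is empty, in accordance with \<open>t\<^sub>j = 0\<close> for \<open>j > n\<close>.\<close>

definition kernel_S :: "nat \<Rightarrow> nat \<Rightarrow> cd \<Rightarrow> (nat \<Rightarrow> real) \<Rightarrow> cd \<Rightarrow> cd" where
  "kernel_S r n p t \<zeta> =
    (let K = 2 ^ r - 1;
         s = (\<lambda>j. \<Sum>k=j..n. t k);
         \<phi> = (\<lambda>j. p j * s j + \<zeta> j);
         M = (\<lambda>k. \<phi> 1 *
               ((\<Sum>j=1..K-1. (\<Prod>m=2..j. sin (\<phi> m)) * cos (\<phi> (j + 1)) * cd_basis j k)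
                + (\<Prod>m=2..K. sin (\<phi> m)) * cd_basis K k))
     in (\<lambda>k. (p 0 * s 1 + \<zeta> 0) * cd_basis 0 k + M k))"

definition params :: "nat \<Rightarrow> nat \<Rightarrow> cd set" where
  "params r n = {z \<in> cd_carrier r. \<forall>m>n. z m = 0}"

definition strip :: "nat \<Rightarrow> nat \<Rightarrow> real \<Rightarrow> real \<Rightarrow> cd set" where
  "strip r n a1 am1 = {p \<in> params r n. a1 < cd_Re r p \<and> cd_Re r p < am1}"

definition integrand ::
  "nat \<Rightarrow> (cd \<Rightarrow> (nat \<Rightarrow> real) \<Rightarrow> cd \<Rightarrow> cd) \<Rightarrow> ((nat \<Rightarrow> real) \<Rightarrow> cd) \<Rightarrow> cd \<Rightarrow> cd \<Rightarrow> (nat \<Rightarrow> real) \<Rightarrow> cd"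
where
  "integrand r u f p \<zeta> t = cd_mult r (f t) (cd_exp r (\<lambda>j. - u p t \<zeta> j))"

text \<open>Integrals of \<open>\<A>\<^sub>r\<close>-valued functions are taken coordinatewise.\<close>

definition image_exists ::
  "nat \<Rightarrow> nat \<Rightarrow> (cd \<Rightarrow> (nat \<Rightarrow> real) \<Rightarrow> cd \<Rightarrow> cd) \<Rightarrow> ((nat \<Rightarrow> real) \<Rightarrow> cd) \<Rightarrow> cd \<Rightarrow> cd \<Rightarrow> bool" where
  "image_exists r n u f p \<zeta> \<longleftrightarrow> (\<forall>j. integrable (Leb n) (\<lambda>t. integrand r u f p \<zeta> t j))"

definition image_F ::
  "nat \<Rightarrow> nat \<Rightarrow> (cd \<Rightarrow> (nat \<Rightarrow> real) \<Rightarrow> cd \<Rightarrow> cd) \<Rightarrow> ((nat \<Rightarrow> real) \<Rightarrow> cd) \<Rightarrow> cd \<Rightarrow> cd \<Rightarrow> cd" where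
  "image_F r n u f p \<zeta> = (\<lambda>j. LINT t|Leb n. integrand r u f p \<zeta> t j)"

end

theory Submission
  imports Defs
begin

text \<open>
  Both kernels depend on \<open>p\<close> and \<open>t\<close> only through the products \<open>p\<^sub>j t\<^sub>k\<close>, so replacing
  \<open>t\<close> by \<open>\<alpha> t\<close> and \<open>p\<close> by \<open>p/\<alpha>\<close> leaves them unchanged, and the formula is the change of
  variables \<open>t \<mapsto> \<alpha> t\<close>. Convergence rests on two facts: \<open>z\<^sup>2 = 2 Re(z) z - |z|\<^sup>2\<close> makes the subalgebra
  generated by \<open>z\<close> a copy of the complex numbers, whence the coordinates of \<open>exp(z)\<close> are at most
  \<open>e\<^bsup>Re(z)\<^esup>\<close> in absolute value; and multiplication is bounded in the \<open>l\<^sub>1\<close> norm. As the real part of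
  either kernel is \<open>p\<^sub>0(t\<^sub>1 + \<dots> + t\<^sub>n) + \<zeta>\<^sub>0\<close>, the integrand is dominated by a product of functions
  of one variable that decay exponentially at both ends.
\<close>

section \<open>Multiplication and exponential\<close>

text \<open>The case \<open>r = 0\<close> stands apart because \<open>cd_conj 0\<close> is the
  identity on all families, including coordinates outside the carrier, while for
  \<open>r > 0\<close> the pairing cuts these off to 0.\<close>

lemma cd_conj_apply: "cd_conj r z j = (if j = 0 then z 0 else if r = 0 then z j else if j < 2 ^ r then - z j else 0)"
proof (induction r arbitrary: z j)
  case 0
  then show ?case by simp
next
  case (Suc r)
  then show ?case
    by (cases "r = 0") (auto simp: cd_pair_def cd_fst_def cd_snd_def less_2_cases_iff)
qed

lemma cd_conj_0 [simp]: "cd_conj r z 0 = z 0"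
  by (simp add: cd_conj_apply)

lemma cd_Re_eq: "cd_Re r z = z 0"
  by (simp add: cd_Re_def cd_conj_apply)

lemma cd_mult_Suc_lower:
  "j < 2 ^ r \<Longrightarrow> cd_mult (Suc r) x y j =
    cd_mult r (cd_fst r x) (cd_fst r y) j - cd_mult r (cd_conj r (cd_snd r y)) (cd_snd r x) j"
  by (simp add: cd_pair_def Let_def)

lemma cd_mult_Suc_upper:
  "j < 2 ^ r \<Longrightarrow> cd_mult (Suc r) x y (2 ^ r + j) =
    cd_mult r (cd_snd r y) (cd_fst r x) j + cd_mult r (cd_snd r x) (cd_conj r (cd_fst r y)) j"
  by (simp add: cd_pair_def Let_def)

lemma cd_mult_zero_outside: "2 ^ r \<le> j \<Longrightarrow> cd_mult r x y j = 0"
proof (induction r)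
  case 0
  then show ?case by simp
next
  case (Suc r)
  then have "\<not> j < 2 ^ Suc r" "\<not> j < 2 ^ r" by auto
  then show ?case by (simp add: cd_pair_def Let_def)
qed

text \<open>These are the three branches of \<open>cd_pair\<close>; identities in the doubled
  algebra are checked on each range separately.\<close>

lemma index_Suc_cases:
  fixes j :: nat
  obtains (lower) "j < 2 ^ r" | (upper) i where "i < 2 ^ r" "j = 2 ^ r + i" | (outside) "2 ^ Suc r \<le> j"
proof -
  have "j - 2 ^ r < 2 ^ r \<and> j = 2 ^ r + (j - 2 ^ r)" if "\<not> j < 2 ^ r" "\<not> 2 ^ Suc r \<le> j"
    using that by auto
  then show ?thesis using that by blast
qed

lemma cd_conj_linear:
  "cd_conj r (\<lambda>j. a * x j + b * y j) = (\<lambda>j. a * cd_conj r x j + b * cd_conj r y j)"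
  by (rule ext) (simp add: cd_conj_apply)

lemma cd_fst_linear:
  "cd_fst r (\<lambda>j. a * x j + b * y j) = (\<lambda>j. a * cd_fst r x j + b * cd_fst r y j)"
  by (rule ext) (simp add: cd_fst_def)

lemma cd_snd_linear:
  "cd_snd r (\<lambda>j. a * x j + b * y j) = (\<lambda>j. a * cd_snd r x j + b * cd_snd r y j)"
  by (rule ext) (simp add: cd_snd_def)

text \<open>Both statements go through one induction, since the doubling formula exchanges factors:
  linearity on the left at level \<open>Suc r\<close> uses linearity on the right at level
  \<open>r\<close>, and conversely.\<close>

lemma cd_mult_linear:
  "cd_mult r (\<lambda>j. a * x j + b * y j) z = (\<lambda>k. a * cd_mult r x z k + b * cd_mult r y z k)"
  "cd_mult r z (\<lambda>j. a * x j + b * y j) = (\<lambda>k. a * cd_mult r z x k + b * cd_mult r z y k)"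
proof (induction r arbitrary: x y z)
  case 0
  {
    case 1
    then show ?case by (auto simp: algebra_simps)
  next
    case 2
    then show ?case by (auto simp: algebra_simps)
  }
next
  case (Suc r)
  {
    case 1
    show ?case
    proof
      fix j show "cd_mult (Suc r) (\<lambda>j. a * x j + b * y j) z j =
        a * cd_mult (Suc r) x z j + b * cd_mult (Suc r) y z j"
        by (cases j r rule: index_Suc_cases)
          (simp_all only: cd_mult_Suc_lower cd_mult_Suc_upper cd_fst_linear cd_snd_linear
             cd_conj_linear Suc, simp_all add: cd_mult_zero_outside algebra_simps del: cd_mult.simps)
    qed
  next
    case 2
    show ?case
    proof
      fix j show "cd_mult (Suc r) z (\<lambda>j. a * x j + b * y j) j =
        a * cd_mult (Suc r) z x j + b * cd_mult (Suc r) z y j"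
        by (cases j r rule: index_Suc_cases)
          (simp_all only: cd_mult_Suc_lower cd_mult_Suc_upper cd_fst_linear cd_snd_linear
             cd_conj_linear Suc, simp_all add: cd_mult_zero_outside algebra_simps del: cd_mult.simps)
    qed
  }
qed

lemma cd_fst_basis_0: "cd_fst r (cd_basis 0) = cd_basis 0"
  by (auto simp: cd_fst_def cd_basis_def)

lemma cd_snd_basis_0: "cd_snd r (cd_basis 0) = (\<lambda>j. 0)"
  by (auto simp: cd_snd_def cd_basis_def)

lemma cd_conj_basis_0: "cd_conj r (cd_basis 0) = cd_basis 0"
  by (auto simp: cd_conj_apply cd_basis_def)

lemma cd_mult_zero: "cd_mult r (\<lambda>j. 0) x = (\<lambda>j. 0)" "cd_mult r x (\<lambda>j. 0) = (\<lambda>j. 0)"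
  using cd_mult_linear(1)[of r 0 x 0 x x] cd_mult_linear(2)[of r x 0 x 0 x] by simp_all

lemma cd_conj_zero: "cd_conj r (\<lambda>j. 0) = (\<lambda>j. 0)"
  by (auto simp: cd_conj_apply)

text \<open>The truncation appears because \<open>x\<close> is an arbitrary family; on the carrier
  it is \<open>x\<close> itself.\<close>

lemma cd_mult_one:
  "cd_mult r x (cd_basis 0) = (\<lambda>j. if j < 2 ^ r then x j else 0)"
  "cd_mult r (cd_basis 0) x = (\<lambda>j. if j < 2 ^ r then x j else 0)"
proof (induction r arbitrary: x)
  case 0
  {
    case 1
    then show ?case by (auto simp: cd_basis_def)
  next
    case 2
    then show ?case by (auto simp: cd_basis_def)
  }
next
  case (Suc r)
  {
    case 1
    show ?case
    proof
      fix j show "cd_mult (Suc r) x (cd_basis 0) j = (if j < 2 ^ Suc r then x j else 0)"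
        by (cases j r rule: index_Suc_cases)
          (simp_all add: cd_mult_Suc_lower cd_mult_Suc_upper cd_fst_basis_0 cd_snd_basis_0
            cd_conj_basis_0 cd_mult_zero cd_conj_zero Suc cd_mult_zero_outside cd_fst_def[of _ x]
            cd_snd_def[of _ x] del: cd_mult.simps)
    qed
  next
    case 2
    show ?case
    proof
      fix j show "cd_mult (Suc r) (cd_basis 0) x j = (if j < 2 ^ Suc r then x j else 0)"
        by (cases j r rule: index_Suc_cases)
          (simp_all add: cd_mult_Suc_lower cd_mult_Suc_upper cd_fst_basis_0 cd_snd_basis_0
            cd_conj_basis_0 cd_mult_zero cd_conj_zero Suc cd_mult_zero_outside cd_fst_def[of _ x]
            cd_snd_def[of _ x] del: cd_mult.simps)
    qed
  }
qed

section \<open>Euclidean norm, quadratic identity and bound for products\<close>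

lemma sum_split_power_Suc:
  fixes g :: "nat \<Rightarrow> real"
  shows "(\<Sum>j<2 ^ Suc r. g j) = (\<Sum>j<2 ^ r. g j) + (\<Sum>j<2 ^ r. g (2 ^ r + j))"
proof -
  have "(\<Sum>j<m + n. g j) = (\<Sum>j<m. g j) + (\<Sum>j<n. g (m + j))" for m n :: nat
    by (induction n) simp_all
  then show ?thesis by (simp add: mult_2)
qed

text \<open>In the induction, conjugating the second component of \<open>y\<close> turns its sum
  around and produces the term \<open>2 * z 0 * w 0\<close>, which cancels the one from the
  induction hypothesis.\<close>

lemma cd_mult_0: "cd_mult r x y 0 = 2 * x 0 * y 0 - (\<Sum>j<2 ^ r. x j * y j)"
proof (induction r arbitrary: x y)
  case 0
  then show ?case by simp
next
  case (Suc r)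
  have conj: "(\<Sum>j<2 ^ r. cd_conj r z j * w j) = 2 * z 0 * w 0 - (\<Sum>j<2 ^ r. z j * w j)" for z w
  proof -
    have "(\<Sum>j<2 ^ r. cd_conj r z j * w j) + (\<Sum>j<2 ^ r. z j * w j)
        = (\<Sum>j::nat<2 ^ r. if j = 0 then 2 * z 0 * w 0 else 0)"
      unfolding sum.distrib[symmetric] by (rule sum.cong) (auto simp: cd_conj_apply algebra_simps)
    also have "\<dots> = 2 * z 0 * w 0" by simp
    finally show ?thesis by simp
  qed
  show ?case
    unfolding sum_split_power_Suc
    by (simp add: cd_mult_Suc_lower Suc conj del: cd_mult.simps)
      (simp add: cd_fst_def cd_snd_def mult.commute)
qed

lemma cd_mult_conj_0: "cd_mult r z (cd_conj r z) 0 = (\<Sum>j<2 ^ r. (z j)\<^sup>2)"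
proof -
  have "(\<Sum>j<2 ^ r. z j * cd_conj r z j) + (\<Sum>j<2 ^ r. (z j)\<^sup>2) = (\<Sum>j::nat<2 ^ r. if j = 0 then 2 * (z 0)\<^sup>2 else 0)"
    unfolding sum.distrib[symmetric] by (rule sum.cong) (auto simp: cd_conj_apply power2_eq_square)
  also have "\<dots> = 2 * (z 0)\<^sup>2" by simp
  finally show ?thesis by (simp add: cd_mult_0 cd_conj_apply power2_eq_square)
qed

lemma cd_norm_eq: "cd_norm r z = sqrt (\<Sum>j<2 ^ r. (z j)\<^sup>2)"
  by (simp add: cd_norm_def cd_mult_conj_0)

lemma abs_coord_le_cd_norm: "j < 2 ^ r \<Longrightarrow> \<bar>z j\<bar> \<le> cd_norm r z"
  unfolding cd_norm_eq by (intro real_le_rsqrt) (auto intro!: member_le_sum)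

text \<open>Replacing each conjugate by 2 Re - identity, the upper half of the square becomes a real
  multiple of the second component, because the two mixed products cancel, and the lower half
  contains only squares of the components, to which the induction hypothesis applies.\<close>

lemma cd_square:
  assumes "j < 2 ^ r"
  shows "cd_mult r x x j = 2 * x 0 * x j - (if j = 0 then \<Sum>i<2 ^ r. (x i)\<^sup>2 else 0)"
  using assms
proof (induction r arbitrary: x j)
  case 0
  then show ?case by (simp add: power2_eq_square)
next
  case (Suc r)
  have eq: "cd_conj r z = (\<lambda>j. (2 * z 0) * cd_basis 0 j + (-1) * z j)" if "\<And>j. 2 ^ r \<le> j \<Longrightarrow> z j = 0" for z :: cd
    by (rule ext) (cases "r = 0"; auto simp: cd_conj_apply cd_basis_def that)
  show ?case
  proof (cases "j = 0")
    case True
    then show ?thesis by (simp add: cd_mult_0 power2_eq_square del: cd_mult.simps)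
  next
    case False
    have conj1: "cd_mult r w (cd_conj r (cd_fst r x)) =
        (\<lambda>j. (2 * cd_fst r x 0) * cd_mult r w (cd_basis 0) j + (-1) * cd_mult r w (cd_fst r x) j)" for w
      by (subst eq) (simp_all only: cd_mult_linear, simp add: cd_fst_def)
    have conj2: "cd_mult r (cd_conj r (cd_snd r x)) w =
        (\<lambda>j. (2 * cd_snd r x 0) * cd_mult r (cd_basis 0) w j + (-1) * cd_mult r (cd_snd r x) w j)" for w
      by (subst eq) (simp_all only: cd_mult_linear, simp add: cd_snd_def)
    show ?thesis using Suc.prems
      by (cases j r rule: index_Suc_cases)
        (use False in \<open>simp_all add: cd_mult_Suc_lower cd_mult_Suc_upper conj1 conj2 cd_mult_one Suc.IH
          del: cd_mult.simps\<close>, simp_all add: cd_fst_def cd_snd_def)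
  qed
qed

text \<open>The l1 norm is additive over the two components, so the right-hand side expands into
  four products of norms. Each coordinate needs only two of them, which is why the constant stays 1
  in the induction.\<close>

lemma cd_mult_l1_bound: "\<bar>cd_mult r x y j\<bar> \<le> (\<Sum>i<2 ^ r. \<bar>x i\<bar>) * (\<Sum>i<2 ^ r. \<bar>y i\<bar>)"
proof (induction r arbitrary: x y j)
  case 0
  then show ?case by (simp add: abs_mult)
next
  case (Suc r)
  let ?l = "\<lambda>z. \<Sum>i<2 ^ r. \<bar>z i :: real\<bar>"
  have conj: "?l (cd_conj r z) = ?l z" for z
    by (rule sum.cong) (auto simp: cd_conj_apply)
  have l: "(\<Sum>i<2 ^ Suc r. \<bar>z i\<bar>) = ?l (cd_fst r z) + ?l (cd_snd r z)" for z :: cd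
    unfolding sum_split_power_Suc by (simp add: cd_fst_def cd_snd_def)
  have nn: "0 \<le> ?l z" for z :: cd by (simp add: sum_nonneg)
  note * = nn[of "cd_fst r x"] nn[of "cd_snd r x"] nn[of "cd_fst r y"] nn[of "cd_snd r y"]
  note ** = mult_nonneg_nonneg[OF *(1) *(3)] mult_nonneg_nonneg[OF *(1) *(4)]
    mult_nonneg_nonneg[OF *(2) *(3)] mult_nonneg_nonneg[OF *(2) *(4)]
  note e = distrib_right[of "?l (cd_fst r x)" "?l (cd_snd r x)"] distrib_left
    mult.commute[of "?l (cd_snd r y)" "?l (cd_snd r x)"] mult.commute[of "?l (cd_snd r y)" "?l (cd_fst r x)"]
  show ?case
  proof (cases j r rule: index_Suc_cases)
    case lower
    show ?thesis
      unfolding cd_mult_Suc_lower[OF lower] l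
      using Suc.IH[of "cd_fst r x" "cd_fst r y" j] Suc.IH[of "cd_conj r (cd_snd r y)" "cd_snd r x" j] **
      unfolding conj e by linarith
  next
    case (upper i)
    show ?thesis
      unfolding upper(2) cd_mult_Suc_upper[OF upper(1)] l
      using Suc.IH[of "cd_snd r y" "cd_fst r x" i] Suc.IH[of "cd_snd r x" "cd_conj r (cd_fst r y)" i] **
      unfolding conj e by linarith
  next
    case outside
    show ?thesis
      unfolding cd_mult_zero_outside[OF outside] l using * by simp
  qed
qed

text \<open>
  With \<open>m = |z - Re(z)|\<close>, the powers of \<open>z\<close> are those of \<open>w = Re(z) + m i\<close> with \<open>i\<close> read as
  \<open>(z - Re(z)) / m\<close>.
\<close>

lemma cd_power_eq:
  assumes "z \<in> cd_carrier r" and m: "m = sqrt (\<Sum>j\<in>{1..<2 ^ r}. (z j)\<^sup>2)" and "m \<noteq> 0"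
  defines "w \<equiv> Complex (z 0) m"
  shows "cd_power r z k = (\<lambda>j. (Re (w ^ k) - z 0 * Im (w ^ k) / m) * cd_basis 0 j + (Im (w ^ k) / m) * z j)"
proof (induction k)
  case 0
  then show ?case by simp
next
  case (Suc k)
  have zj: "z j = 0" if "\<not> j < 2 ^ r" for j
    using assms(1) that by (auto simp: cd_carrier_def)
  have "(\<Sum>i<2 ^ r. (z i)\<^sup>2) = (z 0)\<^sup>2 + (\<Sum>j\<in>{1..<2 ^ r}. (z j)\<^sup>2)"
    by (simp add: lessThan_atLeast0 sum.atLeast_Suc_lessThan)
  then have sq: "(\<Sum>i<2 ^ r. (z i)\<^sup>2) = (z 0)\<^sup>2 + m\<^sup>2"
    by (simp add: m sum_nonneg)
  \<comment> \<open>The complex number \<open>w\<close> has real part \<open>z 0\<close> and squared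
    modulus \<open>(z 0)\<^sup>2 + m\<^sup>2\<close>, so it satisfies the same quadratic relation;
    multiplication by \<open>z\<close> therefore acts on combinations of 1 and \<open>z\<close> as
    multiplication by \<open>w\<close> does.\<close>
  have zz: "cd_mult r z z = (\<lambda>j. 2 * z 0 * z j - ((z 0)\<^sup>2 + m\<^sup>2) * cd_basis 0 j)"
  proof
    fix j show "cd_mult r z z j = 2 * z 0 * z j - ((z 0)\<^sup>2 + m\<^sup>2) * cd_basis 0 j"
      by (cases "j < 2 ^ r") (auto simp: cd_square sq cd_mult_zero_outside zj cd_basis_def)
  qed
  have z1: "cd_mult r z (cd_basis 0) = z"
    by (auto simp: cd_mult_one zj)
  show ?case
    using \<open>m \<noteq> 0\<close>
    unfolding cd_power.simps Suc cd_mult_linear z1 zz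
    by (rule_tac ext) (simp add: w_def field_simps power2_eq_square)
qed

text \<open>The degenerate case, where there is no imaginary direction to divide by: all coordinates
  but the zeroth vanish and \<open>z\<close> is real.\<close>

lemma cd_power_eq_real:
  assumes "z \<in> cd_carrier r" and m: "0 = sqrt (\<Sum>j\<in>{1..<2 ^ r}. (z j)\<^sup>2)"
  shows "cd_power r z k = (\<lambda>j. (z 0) ^ k * cd_basis 0 j)"
proof -
  have "z j = 0" if "j \<noteq> 0" for j
  proof (cases "j < 2 ^ r")
    case True
    have "(\<Sum>j\<in>{1..<2 ^ r}. (z j)\<^sup>2) = 0" using m by simp
    then show ?thesis using True that by (subst (asm) sum_nonneg_eq_0_iff) auto
  next
    case False
    then show ?thesis using assms(1) by (simp add: cd_carrier_def)
  qed
  then have z: "z = (\<lambda>j. z 0 * cd_basis 0 j + 0 * cd_basis 0 j)"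
    by (auto simp: cd_basis_def)
  have "cd_mult r z (\<lambda>j. c * cd_basis 0 j) = (\<lambda>j. z 0 * c * cd_basis 0 j)" for c
    by (subst z) (simp only: cd_mult_linear(1) cd_mult_one, auto simp: cd_basis_def)
  then show ?thesis
    by (induction k) (simp_all)
qed

lemma cd_exp_bound:
  assumes "z \<in> cd_carrier r"
  shows "\<bar>cd_exp r z j\<bar> \<le> exp (z 0)"
proof -
  define m where "m = sqrt (\<Sum>j\<in>{1..<2 ^ r}. (z j)\<^sup>2)"
  show ?thesis
  proof (cases "m = 0")
    case True
    then have eq: "cd_power r z k j / fact k = z 0 ^ k /\<^sub>R fact k * cd_basis 0 j" for k
      using cd_power_eq_real[OF assms, of k] by (simp add: m_def field_simps)
    have "(\<lambda>k. z 0 ^ k /\<^sub>R fact k * cd_basis 0 j) sums (exp (z 0) * cd_basis 0 j)"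
      by (intro sums_mult2 exp_converges)
    then have "cd_exp r z j = exp (z 0) * cd_basis 0 j"
      unfolding cd_exp_def eq by (simp add: sums_iff)
    then show ?thesis by (simp add: cd_basis_def)
  next
    case False
    define w where "w = Complex (z 0) m"
    have "m > 0" using False by (simp add: m_def order_less_le sum_nonneg)
    \<comment> \<open>Each coordinate is a fixed real-linear combination of the real and imaginary
      parts of the terms of the complex exponential series, so it can be summed termwise. The
      coefficient of the imaginary part is a coordinate of the unit vector (z - Re z) / m.\<close>
    have eq: "cd_power r z k j / fact k
      = Re (w ^ k /\<^sub>R fact k) * cd_basis 0 j + Im (w ^ k /\<^sub>R fact k) * ((z j - z 0 * cd_basis 0 j) / m)" for k
      unfolding cd_power_eq[OF assms m_def False] w_def[symmetric]
      using False by (simp add: field_simps)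
    have "(\<lambda>k. Re (w ^ k /\<^sub>R fact k) * cd_basis 0 j + Im (w ^ k /\<^sub>R fact k) * ((z j - z 0 * cd_basis 0 j) / m))
      sums (Re (exp w) * cd_basis 0 j + Im (exp w) * ((z j - z 0 * cd_basis 0 j) / m))"
      by (intro sums_add sums_mult2 sums_Re sums_Im exp_converges)
    then have *: "cd_exp r z j = Re (exp w) * cd_basis 0 j + Im (exp w) * ((z j - z 0 * cd_basis 0 j) / m)"
      unfolding cd_exp_def eq by (simp add: sums_iff)
    have norm: "cmod (exp w) = exp (z 0)" by (simp add: w_def)
    show ?thesis
    proof (cases "j = 0")
      case True
      then show ?thesis using * abs_Re_le_cmod[of "exp w"] norm by (simp add: cd_basis_def)
    next
      case j: False
      have "\<bar>z j\<bar> \<le> m"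
      proof (cases "j < 2 ^ r")
        case True
        with j show ?thesis unfolding m_def by (intro real_le_rsqrt) (auto intro!: member_le_sum)
      next
        case False
        then show ?thesis using assms \<open>m > 0\<close> by (simp add: cd_carrier_def)
      qed
      then have "\<bar>z j / m\<bar> \<le> 1" using \<open>m > 0\<close> by simp
      then have "\<bar>Im (exp w)\<bar> * \<bar>z j / m\<bar> \<le> exp (z 0) * 1"
        using abs_Im_le_cmod[of "exp w"] norm by (intro mult_mono) auto
      then show ?thesis using * j by (simp add: cd_basis_def abs_mult)
    qed
  qed
qed

section \<open>Measurability of products and exponentials\<close>

lemma cd_mult_measurable:
  assumes "\<And>j. (\<lambda>t. x t j) \<in> borel_measurable M" "\<And>j. (\<lambda>t. y t j) \<in> borel_measurable M"
  shows "(\<lambda>t. cd_mult r (x t) (y t) j) \<in> borel_measurable M"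
  using assms
proof (induction r arbitrary: x y j)
  case 0
  then show ?case by simp
next
  case (Suc r)
  have conj: "(\<lambda>t. cd_conj r (z t) i) \<in> borel_measurable M" if "\<And>j. (\<lambda>t. z t j) \<in> borel_measurable M" for z i
    using that by (simp add: cd_conj_apply)
  have fst: "(\<lambda>t. cd_fst r (z t) i) \<in> borel_measurable M" if "\<And>j. (\<lambda>t. z t j) \<in> borel_measurable M" for z i
    using that by (simp add: cd_fst_def)
  have snd: "(\<lambda>t. cd_snd r (z t) i) \<in> borel_measurable M" if "\<And>j. (\<lambda>t. z t j) \<in> borel_measurable M" for z i
    using that by (simp add: cd_snd_def)
  show ?case
    by (cases j r rule: index_Suc_cases)
      (simp_all add: cd_mult_Suc_lower cd_mult_Suc_upper cd_mult_zero_outside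
        borel_measurable_add borel_measurable_diff Suc.IH conj fst snd Suc.prems del: cd_mult.simps)
qed

lemma cd_exp_measurable:
  assumes "\<And>j. (\<lambda>t. x t j) \<in> borel_measurable M"
  shows "(\<lambda>t. cd_exp r (x t) j) \<in> borel_measurable M"
proof -
  have "(\<lambda>t. cd_power r (x t) k i) \<in> borel_measurable M" for k i
    by (induction k arbitrary: i) (simp_all add: cd_mult_measurable assms)
  then show ?thesis
    unfolding cd_exp_def by (intro borel_measurable_suminf borel_measurable_divide) auto
qed

section \<open>Lebesgue measure and dilations\<close>

text \<open>The product measure before completion, for which box generators and measurability of
  coordinates are at hand; facts on \<open>Leb\<close> are obtained from it by completing.\<close>

definition PLeb :: "nat \<Rightarrow> (nat \<Rightarrow> real) measure" where
  "PLeb n = (\<Pi>\<^sub>M j\<in>{1..n}. lborel)"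

lemma Leb_eq: "Leb n = completion (PLeb n)"
  unfolding Leb_def PLeb_def ..

lemma space_PLeb: "space (PLeb n) = Rn n"
  by (simp add: Rn_def PLeb_def space_PiM)

lemma space_Leb: "space (Leb n) = Rn n"
  by (simp add: Leb_eq space_PLeb)

lemma PLeb_coord_measurable: "(\<lambda>t. t j) \<in> borel_measurable (PLeb n)"
proof (cases "j \<in> {1..n}")
  case True
  then have "(\<lambda>t. t j) \<in> PLeb n \<rightarrow>\<^sub>M lborel"
    unfolding PLeb_def by (rule measurable_component_singleton)
  then show ?thesis by simp
next
  case False
  \<comment> \<open>Points of \<open>Rn n\<close> are extensional, so a coordinate outside the index
    range is the constant \<open>undefined\<close>.\<close>
  then show ?thesis
    by (subst measurable_cong[where g = "\<lambda>t. undefined"]) (auto simp: space_PLeb Rn_def PiE_def extensional_def)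
qed

text \<open>The identity is Borel measurable into the product topology because each of its
  coordinates is measurable.\<close>

lemma open_Int_Rn_sets: "open W \<Longrightarrow> W \<inter> Rn n \<in> sets (PLeb n)"
  using measurable_sets[OF measurable_coordinatewise_then_product[of "\<lambda>t. t", OF PLeb_coord_measurable],
      where S = W]
  by (simp add: space_PLeb)

text \<open>
  Up to a null set, the preimage of an open set is the trace of an open set, because it
  contains a neighbourhood of each of its points of continuity.
\<close>

lemma AE_continuous_measurable:
  fixes g :: "(nat \<Rightarrow> real) \<Rightarrow> real"
  assumes "AE t in Leb n. continuous (at t within Rn n) g"
  shows "g \<in> borel_measurable (Leb n)"
proof (rule borel_measurableI)
  fix U :: "real set" assume U: "open U"
  obtain N where N: "N \<in> null_sets (Leb n)" "{t \<in> Rn n. \<not> continuous (at t within Rn n) g} \<subseteq> N"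
    using assms unfolding eventually_ae_filter space_Leb by auto
  define W where "W = \<Union> {V. open V \<and> V \<inter> Rn n \<subseteq> g -` U}"
  have "open W" by (auto simp: W_def)
  have sub: "t \<in> W \<union> N" if "t \<in> Rn n" "g t \<in> U" for t
  proof (rule ccontr)
    assume not: "t \<notin> W \<union> N"
    with that N have "continuous (at t within Rn n) g" by auto
    with U \<open>g t \<in> U\<close> obtain V where "open V" "t \<in> V" "\<forall>y\<in>Rn n. y \<in> V \<longrightarrow> g y \<in> U"
      unfolding continuous_within_topological by meson
    then have "V \<subseteq> W" by (auto simp: W_def)
    with \<open>t \<in> V\<close> not show False by auto
  qed
  have "W \<inter> Rn n \<in> sets (Leb n)"
    unfolding Leb_eq by (rule sets_completionI_sets[OF open_Int_Rn_sets[OF \<open>open W\<close>]])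
  \<comment> \<open>What is left consists of discontinuity points and lies in the null set
    \<open>N\<close>; completeness of the measure makes it measurable.\<close>
  moreover have "{t \<in> Rn n. g t \<in> U} - W \<in> sets (Leb n)"
  proof (rule null_setsD2, unfold Leb_eq, rule null_sets_completion_subset)
    show "{t \<in> Rn n. g t \<in> U} - W \<subseteq> N" using sub by auto
    show "N \<in> null_sets (completion (PLeb n))" using N by (simp add: Leb_eq)
  qed
  moreover have "g -` U \<inter> space (Leb n) = (W \<inter> Rn n) \<union> ({t \<in> Rn n. g t \<in> U} - W)"
    unfolding space_Leb W_def by blast
  ultimately show "g -` U \<inter> space (Leb n) \<in> sets (Leb n)" by (simp only: sets.Un)
qed

section \<open>Change of variables under dilations\<close>

lemma dilate_measurable: "dilate n \<alpha> \<in> PLeb n \<rightarrow>\<^sub>M PLeb n"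
proof -
  have "(\<lambda>t. \<alpha> * t j) \<in> borel_measurable (PLeb n)" for j
    by (intro borel_measurable_times PLeb_coord_measurable) simp
  then show ?thesis
    unfolding dilate_def by (subst (2) PLeb_def) (rule measurable_restrict, simp)
qed

lemma dilate_in_Rn [simp]: "dilate n \<alpha> t \<in> Rn n"
  by (simp add: dilate_def Rn_def)

text \<open>It suffices to compare the measures of boxes. The preimage of a box is a box, and the
  scaling law on the line gives one factor \<alpha> for each of the \<open>n\<close>
  coordinates.\<close>

lemma PLeb_dilate:
  assumes "\<alpha> > 0"
  shows "PLeb n = density (distr (PLeb n) (PLeb n) (dilate n \<alpha>)) (\<lambda>_. ennreal (\<alpha> ^ n))"
proof -
  interpret product_sigma_finite "\<lambda>_::nat. lborel :: real measure" ..
  have "density (distr (PLeb n) (PLeb n) (dilate n \<alpha>)) (\<lambda>_. ennreal (\<alpha> ^ n)) = (\<Pi>\<^sub>M j\<in>{1..n}. lborel)"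
  proof (rule PiM_eqI)
    fix A :: "nat \<Rightarrow> real set" assume A: "\<And>i. i \<in> {1..n} \<Longrightarrow> A i \<in> sets lborel"
    have lb: "emeasure lborel B = ennreal \<alpha> * emeasure lborel ((*) \<alpha> -` B)" if "B \<in> sets lborel" for B :: "real set"
      using arg_cong[OF lborel_distr_mult'[of \<alpha>], of "\<lambda>M. emeasure M B"] that \<open>\<alpha> > 0\<close>
      by (simp add: emeasure_density_const emeasure_distr)
    have m: "(*) \<alpha> -` A i \<in> sets lborel" if "i \<in> {1..n}" for i
      using measurable_sets[of "(*) \<alpha>" borel borel "A i"] A[OF that] by simp
    have P: "Pi\<^sub>E {1..n} A \<in> sets (PLeb n)"
      unfolding PLeb_def using A by (intro sets_PiM_I_finite) auto
    have pre: "dilate n \<alpha> -` Pi\<^sub>E {1..n} A \<inter> space (PLeb n) = Pi\<^sub>E {1..n} (\<lambda>i. (*) \<alpha> -` A i)"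
      by (simp add: space_PLeb Rn_def dilate_def PiE_def extensional_def Pi_iff set_eq_iff conj_commute)
    have "emeasure (density (distr (PLeb n) (PLeb n) (dilate n \<alpha>)) (\<lambda>_. ennreal (\<alpha> ^ n))) (Pi\<^sub>E {1..n} A)
      = ennreal (\<alpha> ^ n) * emeasure (PLeb n) (Pi\<^sub>E {1..n} (\<lambda>i. (*) \<alpha> -` A i))"
      using P by (simp add: emeasure_density_const emeasure_distr[OF dilate_measurable] pre del: One_nat_def)
    also have "\<dots> = ennreal (\<alpha> ^ n) * (\<Prod>i\<in>{1..n}. emeasure lborel ((*) \<alpha> -` A i))"
      unfolding PLeb_def using m by (subst emeasure_PiM) auto
    also have "\<dots> = (\<Prod>i\<in>{1..n}. ennreal \<alpha>) * (\<Prod>i\<in>{1..n}. emeasure lborel ((*) \<alpha> -` A i))"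
      using \<open>\<alpha> > 0\<close> by (simp add: ennreal_power)
    also have "\<dots> = (\<Prod>i\<in>{1..n}. emeasure lborel (A i))"
      unfolding prod.distrib[symmetric] using lb A by (intro prod.cong) auto
    finally show "emeasure (density (distr (PLeb n) (PLeb n) (dilate n \<alpha>)) (\<lambda>_. ennreal (\<alpha> ^ n))) (Pi\<^sub>E {1..n} A)
      = (\<Prod>i\<in>{1..n}. emeasure lborel (A i))" .
  qed (simp_all only: sets_density sets_distr PLeb_def finite_atLeastAtMost)
  then show ?thesis by (simp only: PLeb_def)
qed

text \<open>A positive constant density does not change null sets. This is the condition under which
  measurability of the dilation and its pushforward pass to the completed measures.\<close>

lemma null_sets_distr_dilate:
  assumes "\<alpha> > 0"
  shows "null_sets (distr (Leb n) (PLeb n) (dilate n \<alpha>)) = null_sets (PLeb n)"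
proof -
  have "null_sets (PLeb n) = null_sets (density (distr (PLeb n) (PLeb n) (dilate n \<alpha>)) (\<lambda>_. ennreal (\<alpha> ^ n)))"
    using PLeb_dilate[OF assms, of n] by simp
  also have "\<dots> = null_sets (distr (PLeb n) (PLeb n) (dilate n \<alpha>))"
    using assms by (auto simp: null_sets_def emeasure_density_const)
  finally show ?thesis
    by (simp add: Leb_eq distr_completion[OF dilate_measurable])
qed

lemma dilate_measurable_Leb:
  assumes "\<alpha> > 0"
  shows "dilate n \<alpha> \<in> Leb n \<rightarrow>\<^sub>M Leb n"
proof -
  have "dilate n \<alpha> \<in> completion (PLeb n) \<rightarrow>\<^sub>M completion (PLeb n)"
    by (rule completion.measurable_completion2[OF measurable_completion[OF dilate_measurable]])
      (use null_sets_distr_dilate[OF assms] in \<open>simp add: Leb_eq\<close>)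
  then show ?thesis by (simp add: Leb_eq)
qed

text \<open>Completes both sides of \<open>PLeb_dilate\<close>; completion commutes with the
  constant density and, by equality of null sets, with the pushforward.\<close>

lemma Leb_dilate:
  assumes "\<alpha> > 0"
  shows "Leb n = density (distr (Leb n) (Leb n) (dilate n \<alpha>)) (\<lambda>_. ennreal (\<alpha> ^ n))"
proof -
  have "Leb n = completion (density (distr (PLeb n) (PLeb n) (dilate n \<alpha>)) (\<lambda>_. ennreal (\<alpha> ^ n)))"
    using PLeb_dilate[OF assms, of n] by (simp add: Leb_eq)
  also have "\<dots> = density (completion (distr (PLeb n) (PLeb n) (dilate n \<alpha>))) (\<lambda>_. ennreal (\<alpha> ^ n))"
    using assms by (intro completion_density_eq) auto
  also have "completion (distr (PLeb n) (PLeb n) (dilate n \<alpha>)) = distr (Leb n) (Leb n) (dilate n \<alpha>)"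
    using completion.completion_distr_eq[OF measurable_completion[OF dilate_measurable], of n \<alpha>]
      null_sets_distr_dilate[OF assms, of n]
    by (simp add: Leb_eq distr_completion[OF dilate_measurable])
  finally show ?thesis .
qed

lemma AE_dilate:
  assumes "\<alpha> > 0" "AE t in Leb n. P t"
  shows "AE t in Leb n. P (dilate n \<alpha> t)"
proof -
  have "AE t in distr (Leb n) (Leb n) (dilate n \<alpha>). P t"
    using assms by (subst (asm) Leb_dilate[OF assms(1)]) (simp add: AE_density)
  then show ?thesis by (rule AE_distrD[OF dilate_measurable_Leb[OF assms(1)]])
qed

lemma integral_dilate:
  fixes h :: "(nat \<Rightarrow> real) \<Rightarrow> real"
  assumes "\<alpha> > 0" "h \<in> borel_measurable (Leb n)"
  shows "(LINT t|Leb n. h (dilate n \<alpha> t)) = (LINT t|Leb n. h t) / \<alpha> ^ n"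
proof -
  have "(LINT t|Leb n. h t) = (LINT t|distr (Leb n) (Leb n) (dilate n \<alpha>). \<alpha> ^ n *\<^sub>R h t)"
    using assms by (subst Leb_dilate[OF assms(1)], subst integral_density) auto
  also have "\<dots> = \<alpha> ^ n * (LINT t|Leb n. h (dilate n \<alpha> t))"
    using assms by (subst integral_distr[OF dilate_measurable_Leb]) auto
  finally show ?thesis using assms by simp
qed

lemma dilate_continuous: "continuous (at t within S) (dilate n \<alpha>)"
proof -
  have "continuous_on UNIV (dilate n \<alpha>)"
  proof (rule continuous_on_coordinatewise_then_product)
    show "continuous_on UNIV (\<lambda>t. dilate n \<alpha> t j)" for j
      unfolding dilate_def restrict_def by (cases "j \<in> {1..n}")
        (simp_all only: if_True if_False continuous_on_mult_left continuous_on_product_coordinates continuous_on_const)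
  qed
  then show ?thesis
    by (simp add: continuous_on_eq_continuous_at continuous_at_imp_continuous_at_within)
qed

section \<open>Convergence of the image\<close>

lemma integrable_exp_two_sided:
  fixes a b :: real
  assumes "a < 0" "0 < b"
  shows "integrable lborel (\<lambda>x. exp ((if 0 \<le> x then a else b) * x))"
proof -
  have half: "integrable lborel (\<lambda>x. indicator {0..} x *\<^sub>R exp (- c * x))" if "0 < c" for c :: real
  proof -
    have "set_integrable lebesgue {0..} (\<lambda>x. exp (- c * x))"
      by (intro nonnegative_absolutely_integrable_1 integrable_on_exp_minus_to_infinity that) simp
    then show ?thesis
      unfolding set_integrable_def by (subst (asm) integrable_completion) auto
  qed
  \<comment> \<open>The negative half-line is the positive one reflected, with
    \<open>0 + (-1) * x\<close> in the shape of an affine substitution. At 0 both indicators are 1,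
    so this sum only dominates the function.\<close>
  have "integrable lborel (\<lambda>x. indicator {0..} x *\<^sub>R exp (- (- a) * x)
      + (indicator {0..} (0 + (-1) * x) *\<^sub>R exp (- b * (0 + (-1) * x))))"
    using half[of "- a"] lborel_integrable_real_affine[OF half[of b], of "-1" 0] assms
    by (intro Bochner_Integration.integrable_add) auto
  then show ?thesis
    by (rule Bochner_Integration.integrable_bound) (auto simp: indicator_def)
qed

lemma original_measurable:
  assumes "original r n a1 am1 f"
  shows "(\<lambda>t. f t j) \<in> borel_measurable (Leb n)"
proof (rule AE_continuous_measurable)
  have "AE t in Leb n. continuous (at t within Rn n) f"
    using assms by (simp add: original_def)
  then show "AE t in Leb n. continuous (at t within Rn n) (\<lambda>t. f t j)"
  proof eventually_elim
    case (elim t)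
    have "isCont (\<lambda>z :: cd. z j) (f t)"
      by (rule continuous_on_interior[OF continuous_on_product_coordinates]) simp
    from continuous_within_compose3[OF this elim] show ?case .
  qed
qed

text \<open>Merges the bounds on the single orthants into one: there are finitely many sign
  patterns, and the sum of their positive constants exceeds each of them.\<close>

lemma original_bound:
  assumes "original r n a1 am1 f"
  obtains C where "C > 0"
    "\<And>t. t \<in> Rn n \<Longrightarrow> cd_norm r (f t) \<le> C * exp (\<Sum>j=1..n. (if 0 \<le> t j then a1 else am1) * t j)"
proof -
  let ?V = "{1..n} \<rightarrow>\<^sub>E {-1, 1::real}"
  let ?e = "\<lambda>v t. exp (\<Sum>j=1..n. (if v j = 1 then a1 else am1) * t j)"
  have "\<forall>v\<in>?V. \<exists>C>0. \<forall>t\<in>Rn n. (\<forall>j\<in>{1..n}. v j * t j \<ge> 0) \<longrightarrow> cd_norm r (f t) < C * ?e v t"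
    using assms by (simp add: original_def)
  then have "\<exists>C. \<forall>v\<in>?V. C v > 0 \<and> (\<forall>t\<in>Rn n. (\<forall>j\<in>{1..n}. v j * t j \<ge> 0) \<longrightarrow> cd_norm r (f t) < C v * ?e v t)"
    by (rule bchoice)
  then obtain C where C: "\<And>v. v \<in> ?V \<Longrightarrow> 0 < C v"
    "\<And>v t. v \<in> ?V \<Longrightarrow> t \<in> Rn n \<Longrightarrow> (\<forall>j\<in>{1..n}. v j * t j \<ge> 0) \<Longrightarrow> cd_norm r (f t) < C v * ?e v t"
    by blast
  have fin: "finite ?V" by (intro finite_PiE) auto
  have bound: "cd_norm r (f t) \<le> sum C ?V * exp (\<Sum>j=1..n. (if 0 \<le> t j then a1 else am1) * t j)" if t: "t \<in> Rn n" for t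
  proof -
    \<comment> \<open>The orthant of \<open>t\<close>, a zero coordinate being counted as
      positive.\<close>
    define v where "v = (\<lambda>j\<in>{1..n}. if 0 \<le> t j then 1 else (-1::real))"
    have v: "v \<in> ?V" by (auto simp: v_def)
    have "?e v t = exp (\<Sum>j=1..n. (if 0 \<le> t j then a1 else am1) * t j)"
      by (auto simp: v_def intro!: sum.cong)
    moreover have "cd_norm r (f t) < C v * ?e v t"
      by (rule C(2)[OF v t]) (auto simp: v_def)
    moreover have "C v \<le> sum C ?V"
      using C(1) v fin by (intro member_le_sum) (auto intro: less_imp_le)
    ultimately show ?thesis
      by (smt (verit) mult_right_mono exp_ge_zero)
  qed
  have "(\<lambda>j\<in>{1..n}. 1) \<in> ?V" by auto
  then have "?V \<noteq> {}" by blast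
  then have "sum C ?V > 0" using C(1) by (rule sum_pos[OF fin])
  from that[of "sum C ?V", OF this bound] show thesis .
qed

text \<open>Isolates the properties of a kernel on which convergence rests, so that the Cartesian
  and the spherical case share one argument.\<close>

lemma image_exists_if_kernel_Re:
  assumes f: "original r n a1 am1 f" and p: "a1 < p 0" "p 0 < am1"
    and u_meas: "\<And>j. (\<lambda>t. u p t \<zeta> j) \<in> borel_measurable (PLeb n)"
    and u_0: "\<And>t. u p t \<zeta> 0 = p 0 * (\<Sum>j=1..n. t j) + \<zeta> 0"
    and u_carrier: "\<And>t. u p t \<zeta> \<in> cd_carrier r"
  shows "image_exists r n u f p \<zeta>"
  unfolding image_exists_def
proof
  fix j
  obtain C where C: "C > 0"
    "\<And>t. t \<in> Rn n \<Longrightarrow> cd_norm r (f t) \<le> C * exp (\<Sum>j=1..n. (if 0 \<le> t j then a1 else am1) * t j)"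
    using original_bound[OF f] by blast
  \<comment> \<open>Growth rate of the original minus the decay rate of the kernel. The strip
    condition makes the first exponent negative and the second positive, hence \<open>g\<close>
    decays at both ends.\<close>
  define g where "g x = exp ((if 0 \<le> x then a1 - p 0 else am1 - p 0) * x)" for x
  \<comment> \<open>The two factors \<open>2 ^ r\<close> come from bounding the l1 norms of
    \<open>f t\<close> and of the exponential by the number of coordinates times a bound for
    each.\<close>
  define G where "G t = (2 ^ r * C) * (2 ^ r * exp (- \<zeta> 0)) * (\<Prod>j\<in>{1..n}. g (t j))" for t
  interpret product_sigma_finite "\<lambda>_::nat. lborel :: real measure" ..
  have "integrable lborel g"
    unfolding g_def using p by (intro integrable_exp_two_sided) auto
  then have G: "integrable (PLeb n) G"
    unfolding G_def PLeb_def by (intro integrable_mult_right product_integrable_prod) auto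
  then have "integrable (Leb n) G"
    by (simp add: Leb_eq integrable_completion)
  moreover have "(\<lambda>t. integrand r u f p \<zeta> t j) \<in> borel_measurable (Leb n)"
    unfolding integrand_def
    by (intro cd_mult_measurable cd_exp_measurable original_measurable[OF f] borel_measurable_uminus)
      (auto simp: Leb_eq intro!: measurable_completion u_meas)
  moreover have "norm (integrand r u f p \<zeta> t j) \<le> norm (G t)" if "t \<in> space (Leb n)" for t
  proof -
    have t: "t \<in> Rn n" using that by (simp add: space_Leb)
    let ?E = "cd_exp r (\<lambda>j. - u p t \<zeta> j)"
    have "(\<Sum>i<2 ^ r. \<bar>f t i\<bar>) \<le> (\<Sum>i::nat<2 ^ r. C * exp (\<Sum>j=1..n. (if 0 \<le> t j then a1 else am1) * t j))"
      using C(2)[OF t] by (intro sum_mono order_trans[OF abs_coord_le_cd_norm]) auto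
    then have 1: "(\<Sum>i<2 ^ r. \<bar>f t i\<bar>) \<le> 2 ^ r * (C * exp (\<Sum>j=1..n. (if 0 \<le> t j then a1 else am1) * t j))"
      by simp
    have "(\<lambda>j. - u p t \<zeta> j) \<in> cd_carrier r"
      using u_carrier by (simp add: cd_carrier_def)
    from cd_exp_bound[OF this]
    have "(\<Sum>i<2 ^ r. \<bar>?E i\<bar>) \<le> (\<Sum>i::nat<2 ^ r. exp (- u p t \<zeta> 0))"
      by (intro sum_mono)
    then have 2: "(\<Sum>i<2 ^ r. \<bar>?E i\<bar>) \<le> 2 ^ r * exp (- u p t \<zeta> 0)" by simp
    have "norm (integrand r u f p \<zeta> t j) \<le> (\<Sum>i<2 ^ r. \<bar>f t i\<bar>) * (\<Sum>i<2 ^ r. \<bar>?E i\<bar>)"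
      unfolding integrand_def real_norm_def by (rule cd_mult_l1_bound)
    also have "\<dots> \<le> (2 ^ r * (C * exp (\<Sum>j=1..n. (if 0 \<le> t j then a1 else am1) * t j))) * (2 ^ r * exp (- u p t \<zeta> 0))"
      using C(1) by (intro mult_mono 1 2) (auto intro!: sum_nonneg)
    also have "\<dots> = (2 ^ r * C) * (2 ^ r * exp (- \<zeta> 0)) *
        (exp (\<Sum>j=1..n. (if 0 \<le> t j then a1 else am1) * t j) * exp (- (p 0 * (\<Sum>j=1..n. t j))))"
      by (simp add: u_0 exp_diff exp_minus field_simps exp_add)
    also have "exp (\<Sum>j=1..n. (if 0 \<le> t j then a1 else am1) * t j) * exp (- (p 0 * (\<Sum>j=1..n. t j)))
        = (\<Prod>j\<in>{1..n}. g (t j))"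
      unfolding exp_add[symmetric] g_def exp_sum[OF finite_atLeastAtMost, symmetric]
      by (rule arg_cong[of _ _ exp])
        (auto simp: sum_distrib_left sum_subtractf[symmetric] left_diff_distrib intro!: sum.cong)
    finally show ?thesis
      using C(1) by (simp add: G_def[symmetric] del: One_nat_def) 
  qed
  ultimately show "integrable (Leb n) (\<lambda>t. integrand r u f p \<zeta> t j)"
    by (rule Bochner_Integration.integrable_bound[OF _ _ AE_I2])
qed

section \<open>Dilated originals and kernels\<close>

lemma filterlim_times_pos_at_sided:
  fixes c x :: real assumes "c > 0"
  shows "filterlim (\<lambda>y. c * y) (at_left (c * x)) (at_left x)" "filterlim (\<lambda>y. c * y) (at_right (c * x)) (at_right x)"
proof -
  show "filterlim (\<lambda>y. c * y) (at_left (c * x)) (at_left x)"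
    using assms unfolding filterlim_at
    by (auto intro: tendsto_mult_left tendsto_ident_at simp: eventually_at_filter)
  show "filterlim (\<lambda>y. c * y) (at_right (c * x)) (at_right x)"
    using assms unfolding filterlim_at
    by (auto intro: tendsto_mult_left tendsto_ident_at simp: eventually_at_filter)
qed

lemma isCont_scale_imp:
  fixes g :: "real \<Rightarrow> 'a::topological_space"
  assumes "isCont g (c * x)"
  shows "isCont (\<lambda>y. g (c * y)) x"
  by (rule isCont_o2[where f = "\<lambda>y. c * y" and g = g, OF _ assms]) simp

lemma isCont_scale:
  fixes g :: "real \<Rightarrow> 'a::topological_space"
  assumes "c > 0"
  shows "isCont (\<lambda>y. g (c * y)) x \<longleftrightarrow> isCont g (c * x)"
proof
  assume *: "isCont (\<lambda>y. g (c * y)) x"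
  have "isCont (\<lambda>y. g (c * ((1 / c) * y))) (c * x)"
    by (rule isCont_scale_imp[where g = "\<lambda>y. g (c * y)" and c = "1 / c"]) (use * assms in simp)
  then show "isCont g (c * x)" using assms by simp
qed (rule isCont_scale_imp)

lemma first_kind_scale_imp:
  assumes "c > 0" "first_kind_discontinuity g (c * x)"
  shows "first_kind_discontinuity (\<lambda>y. g (c * y)) x"
proof -
  obtain l m where "\<not> isCont g (c * x)" "(g \<longlongrightarrow> l) (at_left (c * x))" "(g \<longlongrightarrow> m) (at_right (c * x))"
    using assms(2) by (auto simp: first_kind_discontinuity_def)
  then show ?thesis
    unfolding first_kind_discontinuity_def isCont_scale[OF assms(1)]
    using filterlim_compose[OF _ filterlim_times_pos_at_sided(1)[OF assms(1)]]
      filterlim_compose[OF _ filterlim_times_pos_at_sided(2)[OF assms(1)]] by blast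
qed

lemma first_kind_scale:
  assumes "c > 0"
  shows "first_kind_discontinuity (\<lambda>y. g (c * y)) x \<longleftrightarrow> first_kind_discontinuity g (c * x)"
proof
  assume *: "first_kind_discontinuity (\<lambda>y. g (c * y)) x"
  have "first_kind_discontinuity (\<lambda>y. g (c * ((1 / c) * y))) (c * x)"
    by (rule first_kind_scale_imp[of "1 / c" "\<lambda>y. g (c * y)"]) (use * assms in simp_all)
  then show "first_kind_discontinuity g (c * x)" using assms by simp
qed (rule first_kind_scale_imp[OF assms])

lemma finitely_many_first_kind_scale:
  assumes "c > 0" "finitely_many_first_kind_discontinuities g"
  shows "finitely_many_first_kind_discontinuities (\<lambda>y. g (c * y))"
  unfolding finitely_many_first_kind_discontinuities_def
proof (intro conjI allI impI)
  fix a b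
  have "{x \<in> {a..b}. \<not> isCont (\<lambda>y. g (c * y)) x} \<subseteq> (\<lambda>x. x / c) ` {x \<in> {c * a..c * b}. \<not> isCont g x}"
  proof
    fix x assume "x \<in> {x \<in> {a..b}. \<not> isCont (\<lambda>y. g (c * y)) x}"
    then show "x \<in> (\<lambda>x. x / c) ` {x \<in> {c * a..c * b}. \<not> isCont g x}"
      using assms(1) by (intro image_eqI[of _ _ "c * x"]) (auto simp: isCont_scale)
  qed
  then show "finite {x \<in> {a..b}. \<not> isCont (\<lambda>y. g (c * y)) x}"
    by (rule finite_subset) (use assms(2) in \<open>simp add: finitely_many_first_kind_discontinuities_def\<close>)
next
  fix x assume "\<not> isCont (\<lambda>y. g (c * y)) x"
  with assms show "first_kind_discontinuity (\<lambda>y. g (c * y)) x"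
    by (simp add: isCont_scale first_kind_scale finitely_many_first_kind_discontinuities_def)
qed

text \<open>The exponent is kept, the constant picks up \<open>c powr \<beta>\<close> from the
  increment \<open>c * h\<close>, and the radius shrinks to \<open>\<delta> / c\<close>.\<close>

lemma holder_at_scale:
  assumes "c > 0" "holder_at r g (c * x)"
  shows "holder_at r (\<lambda>y. g (c * y)) x"
proof -
  obtain \<beta> A \<delta> where h: "0 < \<beta>" "\<beta> \<le> 1" "0 < A" "0 < \<delta>"
    "\<And>h. \<bar>h\<bar> < \<delta> \<Longrightarrow> cd_norm r (\<lambda>k. g (c * x + h) k - g (c * x) k) \<le> A * \<bar>h\<bar> powr \<beta>"
    using assms(2) unfolding holder_at_def by blast
  have "cd_norm r (\<lambda>k. g (c * (x + h)) k - g (c * x) k) \<le> (A * c powr \<beta>) * \<bar>h\<bar> powr \<beta>" if "\<bar>h\<bar> < \<delta> / c" for h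
    using h(5)[of "c * h"] that assms(1)
    by (simp add: abs_mult powr_mult distrib_left pos_less_divide_eq mult.commute mult.left_commute)
  then show ?thesis
    unfolding holder_at_def using h assms(1)
    by (intro exI[of _ \<beta>] exI[of _ "A * c powr \<beta>"] exI[of _ "\<delta> / c"]) auto
qed

text \<open>Partial functions of the dilated original are thereby rescaled partial functions of
  \<open>f\<close> through the dilated point.\<close>

lemma dilate_fun_upd: "j \<in> {1..n} \<Longrightarrow> dilate n \<alpha> (t(j := x)) = (dilate n \<alpha> t)(j := \<alpha> * x)"
  by (auto simp: dilate_def)

text \<open>Dilation by a positive factor preserves null sets and every orthant. The bound of
  \<open>f\<close> at the dilated point has the same constant, and its exponents are multiplied by
  \<alpha>.\<close>

lemma original_dilate:
  assumes "\<alpha> > 0" and f: "original r n a1 am1 f"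
  shows "original r n (\<alpha> * a1) (\<alpha> * am1) (\<lambda>t. f (dilate n \<alpha> t))"
  unfolding original_def
proof (intro conjI ballI impI)
  show "(\<lambda>t. f (dilate n \<alpha> t)) \<in> Rn n \<rightarrow> cd_carrier r"
    using f by (auto simp: original_def)
  have "AE t in Leb n. continuous (at t within Rn n) f"
    using f by (simp add: original_def)
  from AE_dilate[OF assms(1) this]
  show "AE t in Leb n. continuous (at t within Rn n) (\<lambda>t. f (dilate n \<alpha> t))"
  proof eventually_elim
    case (elim t)
    then show ?case
      by (intro continuous_within_compose2[OF dilate_continuous] continuous_within_subset[OF elim]) auto
  qed
next
  fix t j assume t: "t \<in> Rn n" "j \<in> {1..n}"
  show "finitely_many_first_kind_discontinuities (\<lambda>x. f (dilate n \<alpha> (t(j := x))))"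
    unfolding dilate_fun_upd[OF t(2)] using f t
    by (intro finitely_many_first_kind_scale[OF assms(1), of "\<lambda>x. f ((dilate n \<alpha> t)(j := x))"])
      (simp add: original_def)
next
  fix t j assume t: "t \<in> Rn n" "j \<in> {1..n}"
    and *: "\<not> first_kind_discontinuity (\<lambda>x. f (dilate n \<alpha> (t(j := x)))) (t j)"
  have d: "dilate n \<alpha> t j = \<alpha> * t j" using t by (simp add: dilate_def)
  have "\<not> first_kind_discontinuity (\<lambda>x. f ((dilate n \<alpha> t)(j := x))) (\<alpha> * t j)"
    using * unfolding dilate_fun_upd[OF t(2)]
    using first_kind_scale[OF assms(1), of "\<lambda>x. f ((dilate n \<alpha> t)(j := x))"] by simp
  then have "holder_at r (\<lambda>x. f ((dilate n \<alpha> t)(j := x))) (\<alpha> * t j)"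
    using f t(2) d[symmetric] dilate_in_Rn unfolding original_def by metis
  then show "holder_at r (\<lambda>x. f (dilate n \<alpha> (t(j := x)))) (t j)"
    unfolding dilate_fun_upd[OF t(2)] by (rule holder_at_scale[OF assms(1)])
next
  fix v assume v: "v \<in> {1..n} \<rightarrow>\<^sub>E {- 1, 1::real}"
  obtain C where C: "C > 0" "\<And>t. t \<in> Rn n \<Longrightarrow> (\<forall>j\<in>{1..n}. v j * t j \<ge> 0) \<Longrightarrow>
       cd_norm r (f t) < C * exp (\<Sum>j=1..n. (if v j = 1 then a1 else am1) * t j)"
    using f v unfolding original_def by meson
  have bound: "cd_norm r (f (dilate n \<alpha> t)) < C * exp (\<Sum>j=1..n. (if v j = 1 then \<alpha> * a1 else \<alpha> * am1) * t j)"
    if "t \<in> Rn n" "\<forall>j\<in>{1..n}. v j * t j \<ge> 0" for t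
  proof -
    have "(\<Sum>j=1..n. (if v j = 1 then a1 else am1) * dilate n \<alpha> t j)
        = (\<Sum>j=1..n. (if v j = 1 then \<alpha> * a1 else \<alpha> * am1) * t j)"
      by (rule sum.cong) (auto simp: dilate_def)
    moreover have "\<forall>j\<in>{1..n}. v j * dilate n \<alpha> t j \<ge> 0"
      using that(2) assms(1) by (auto simp: dilate_def mult.left_commute[of _ \<alpha>])
    ultimately show ?thesis
      using C(2)[of "dilate n \<alpha> t"] by simp
  qed
  show "\<exists>C>0. \<forall>t\<in>Rn n. (\<forall>j\<in>{1..n}. 0 \<le> v j * t j) \<longrightarrow>
      cd_norm r (f (dilate n \<alpha> t)) < C * exp (\<Sum>j=1..n. (if v j = 1 then \<alpha> * a1 else \<alpha> * am1) * t j)"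
    using bound C(1) by (intro exI[of _ C]) auto
qed

section \<open>Dilation, real part, range and measurability of the kernels\<close>

lemma kernel_C_dilate:
  assumes "\<alpha> > 0"
  shows "kernel_C n p t \<zeta> = kernel_C n (\<lambda>j. p j / \<alpha>) (dilate n \<alpha> t) \<zeta>"
proof -
  have "(\<Sum>j=1..n. dilate n \<alpha> t j) = \<alpha> * (\<Sum>j=1..n. t j)"
    unfolding sum_distrib_left by (rule sum.cong) (auto simp: dilate_def)
  moreover have "(\<Sum>j=1..n. p j / \<alpha> * dilate n \<alpha> t j * cd_basis j k) = (\<Sum>j=1..n. p j * t j * cd_basis j k)" for k
    using assms by (intro sum.cong) (auto simp: dilate_def)
  ultimately show ?thesis
    using assms unfolding kernel_C_def by (intro ext) simp
qed

lemma kernel_S_dilate: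
  assumes "\<alpha> > 0"
  shows "kernel_S r n p t \<zeta> = kernel_S r n (\<lambda>j. p j / \<alpha>) (dilate n \<alpha> t) \<zeta>"
proof -
  \<comment> \<open>The condition \<open>1 \<le> j\<close> keeps index 0 out of the sum, where the
    dilated point has the value \<open>undefined\<close>. All indices in the spherical kernel
    satisfy it.\<close>
  have s: "(\<Sum>k=j..n. dilate n \<alpha> t k) = \<alpha> * (\<Sum>k=j..n. t k)" if "1 \<le> j" for j
    unfolding sum_distrib_left using that by (intro sum.cong) (auto simp: dilate_def)
  have \<phi>: "p j / \<alpha> * (\<Sum>k=j..n. dilate n \<alpha> t k) = p j * (\<Sum>k=j..n. t k)" if "1 \<le> j" for j
    using s[OF that] assms by simp
  have P: "(\<Prod>m=2..j. sin (p m / \<alpha> * (\<Sum>k=m..n. dilate n \<alpha> t k) + \<zeta> m))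
      = (\<Prod>m=2..j. sin (p m * (\<Sum>k=m..n. t k) + \<zeta> m))" for j :: nat
  proof (rule prod.cong[OF refl])
    fix m assume "m \<in> {2..j}"
    then have "1 \<le> m" by simp
    then show "sin (p m / \<alpha> * (\<Sum>k=m..n. dilate n \<alpha> t k) + \<zeta> m) = sin (p m * (\<Sum>k=m..n. t k) + \<zeta> m)"
      by (simp only: \<phi>)
  qed
  have C: "(\<Sum>j=1..m. h j * cos (p (j + 1) / \<alpha> * (\<Sum>k=j + 1..n. dilate n \<alpha> t k) + \<zeta> (j + 1)) * cd_basis j i)
      = (\<Sum>j=1..m. h j * cos (p (j + 1) * (\<Sum>k=j + 1..n. t k) + \<zeta> (j + 1)) * cd_basis j i)" for m i h
    by (simp only: \<phi>[OF le_add2])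
  show ?thesis
    unfolding kernel_S_def Let_def P C using assms \<phi>[of 1] s[of 1] by (simp del: One_nat_def)
qed

lemma kernel_C_0: "kernel_C n p t \<zeta> 0 = p 0 * (\<Sum>j=1..n. t j) + \<zeta> 0"
  by (simp add: kernel_C_def cd_basis_def)

lemma kernel_S_0:
  assumes "1 \<le> r"
  shows "kernel_S r n p t \<zeta> 0 = p 0 * (\<Sum>j=1..n. t j) + \<zeta> 0"
proof -
  \<comment> \<open>This gives \<open>2 ^ r - 1 \<noteq> 0\<close>, so the last basis element of the
    kernel is not the unit and leaves the real part alone.\<close>
  have "(2::nat) ^ 1 \<le> 2 ^ r" using assms by (intro power_increasing) auto
  then show ?thesis
    by (simp add: kernel_S_def cd_basis_def Let_def)
qed

lemma kernel_C_carrier: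
  assumes "n < 2 ^ r" "\<zeta> \<in> params r n"
  shows "kernel_C n p t \<zeta> \<in> cd_carrier r"
proof -
  have "kernel_C n p t \<zeta> k = 0" if k: "2 ^ r \<le> k" for k
  proof -
    have "k \<noteq> 0" using k by (metis not_less_zero less_le_trans zero_less_power zero_less_numeral)
    moreover have "(\<Sum>j=1..n. p j * t j * cd_basis j k) = 0"
      using k assms(1) by (intro sum.neutral) (auto simp: cd_basis_def)
    ultimately show ?thesis
      using assms(2) k by (simp add: kernel_C_def params_def cd_carrier_def cd_basis_def del: One_nat_def)
  qed
  then show ?thesis by (simp add: cd_carrier_def)
qed

lemma kernel_S_carrier: "kernel_S r n p t \<zeta> \<in> cd_carrier r"
proof -
  have "kernel_S r n p t \<zeta> k = 0" if k: "2 ^ r \<le> k" for k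
  proof -
    have pos: "(0::nat) < 2 ^ r" by simp
    then have "k \<noteq> 0" "k \<noteq> 2 ^ r - 1" using k by linarith+
    moreover have "(\<Sum>j=1..2 ^ r - 1 - 1. h j * cd_basis j k) = 0" for h
    proof (rule sum.neutral, rule ballI)
      fix j :: nat assume "j \<in> {1..2 ^ r - 1 - 1}"
      then have "j \<noteq> k" using k pos by (simp only: atLeastAtMost_iff) linarith
      then show "h j * cd_basis j k = 0" by (simp add: cd_basis_def)
    qed
    ultimately show ?thesis
      by (simp add: kernel_S_def Let_def cd_basis_def del: One_nat_def)
  qed
  then show ?thesis by (simp add: cd_carrier_def)
qed

lemma kernel_C_measurable: "(\<lambda>t. kernel_C n p t \<zeta> k) \<in> borel_measurable (PLeb n)"
proof -
  note [measurable] = PLeb_coord_measurable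
  show ?thesis unfolding kernel_C_def by measurable
qed

lemma kernel_S_measurable: "(\<lambda>t. kernel_S r n p t \<zeta> k) \<in> borel_measurable (PLeb n)"
proof -
  note [measurable] = PLeb_coord_measurable
  show ?thesis unfolding kernel_S_def Let_def by measurable
qed

text \<open>Since the growth exponents of the dilated function are scaled by \<alpha>, its strip is
  the original one scaled by \<alpha>, and \<open>p / \<alpha>\<close> falls into the strip of
  \<open>f\<close>.\<close>

theorem theorem11:
  fixes r n :: nat and \<alpha> a1 am1 :: real
    and f :: "(nat \<Rightarrow> real) \<Rightarrow> cd"
    and u :: "cd \<Rightarrow> (nat \<Rightarrow> real) \<Rightarrow> cd \<Rightarrow> cd"
  assumes "2 \<le> r" and "2 ^ (r - 1) \<le> n" and "n \<le> 2 ^ r - 1"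
    and "\<alpha> > 0"
    and "original r n a1 am1 f"
    and "u = kernel_C n \<or> u = kernel_S r n"
  shows "original r n (\<alpha> * a1) (\<alpha> * am1) (\<lambda>t. f (dilate n \<alpha> t)) \<and>
    (\<forall>p \<in> strip r n (\<alpha> * a1) (\<alpha> * am1). \<forall>\<zeta> \<in> params r n.
       (\<lambda>j. p j / \<alpha>) \<in> strip r n a1 am1 \<and>
       image_exists r n u (\<lambda>t. f (dilate n \<alpha> t)) p \<zeta> \<and>
       image_F r n u (\<lambda>t. f (dilate n \<alpha> t)) p \<zeta> =
         (\<lambda>j. image_F r n u f (\<lambda>j. p j / \<alpha>) \<zeta> j / \<alpha> ^ n))"
proof (intro conjI ballI)
  have n: "n < 2 ^ r" using assms(3) by (simp add: le_diff_conv2 Suc_le_eq)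
  show fd: "original r n (\<alpha> * a1) (\<alpha> * am1) (\<lambda>t. f (dilate n \<alpha> t))"
    by (rule original_dilate[OF assms(4,5)])
  \<comment> \<open>Stated for any original because it serves twice: for the dilated function at
    \<open>p\<close>, and for \<open>f\<close> at \<open>p / \<alpha>\<close>, where it supplies the
    measurability that the change of variables requires.\<close>
  have exists: "image_exists r n u g q \<zeta>"
    if "original r n b1 bm1 g" "q \<in> strip r n b1 bm1" "\<zeta> \<in> params r n" for g q \<zeta> b1 bm1
    using assms(6)
  proof
    assume "u = kernel_C n"
    with that show ?thesis
      by (intro image_exists_if_kernel_Re[OF that(1)])
        (auto simp: strip_def cd_Re_eq kernel_C_0 simp del: One_nat_def
          intro: kernel_C_carrier[OF n] kernel_C_measurable)
  next
    assume "u = kernel_S r n"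
    with that show ?thesis using assms(1)
      by (intro image_exists_if_kernel_Re[OF that(1)])
        (auto simp: strip_def cd_Re_eq kernel_S_0 simp del: One_nat_def
          intro: kernel_S_carrier kernel_S_measurable)
  qed
  fix p \<zeta> assume p: "p \<in> strip r n (\<alpha> * a1) (\<alpha> * am1)" and \<zeta>: "\<zeta> \<in> params r n"
  show q: "(\<lambda>j. p j / \<alpha>) \<in> strip r n a1 am1"
    using p assms(4) by (auto simp: strip_def cd_Re_eq params_def cd_carrier_def field_simps)
  show "image_exists r n u (\<lambda>t. f (dilate n \<alpha> t)) p \<zeta>"
    by (rule exists[OF fd p \<zeta>])
  have "u p t \<zeta> = u (\<lambda>j. p j / \<alpha>) (dilate n \<alpha> t) \<zeta>" for t
    using assms(6) kernel_C_dilate[OF assms(4)] kernel_S_dilate[OF assms(4)] by metis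
  then have eq: "integrand r u (\<lambda>t. f (dilate n \<alpha> t)) p \<zeta> t
      = integrand r u f (\<lambda>j. p j / \<alpha>) \<zeta> (dilate n \<alpha> t)" for t
    by (simp add: integrand_def)
  show "image_F r n u (\<lambda>t. f (dilate n \<alpha> t)) p \<zeta> =
      (\<lambda>j. image_F r n u f (\<lambda>j. p j / \<alpha>) \<zeta> j / \<alpha> ^ n)"
    unfolding image_F_def eq
    by (intro ext integral_dilate[OF assms(4)])
      (use exists[OF assms(5) q \<zeta>] in \<open>auto simp: image_exists_def intro: borel_measurable_integrable\<close>)
qed

end
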